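(* Under the hypotheses of the main theorem, for each $t\ge0$ let $Z_t^n=\int_0^t\sum_{i\ge2}Q_i^n(s)\,ds$ denote the aggregate waiting time over $[0,t]$. Then \[\lim_{C\to\infty}\limsup_{n\to\infty}\mathbb{P}\big(Z_t^n\ge C\sqrt n\big)=0.\]
   Context: Model: $n$ parallel FIFO queues (one per server), exponential rate-1 services, Poisson arrivals of rate $\lambda_n n$ with $0<\lambda_n<1$ and $\sqrt n(1-\lambda_n)\to\beta>0$, each arrival joins a shortest queue (ties uniformly at random); $Q_i^n(t)$ = number of queues with at least $i$ customers, so $\sum_{i\ge2}Q_i^n(t)$ is the number of customers waiting at time $t$. Hypotheses: $((Q_1^n(0)-n)/\sqrt n, Q_2^n(0)/\sqrt n,\dots,Q_k^n(0)/\sqrt n)$ converges weakly in $\mathbb{R}^k$ for some $k\ge3$, and $Q_i^n(0)=0$ for $i>k$. *)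

theory Defs
  imports "HOL-Probability.Probability"
begin

text \<open>A state of the n-server system is x :: nat => nat with x i = Q_i = number of
queues with at least i customers (so x 0 = n).\<close>

definition valid_state :: "nat \<Rightarrow> (nat \<Rightarrow> nat) \<Rightarrow> bool" where
  "valid_state n x \<longleftrightarrow> x 0 = n \<and> antimono x \<and> (\<exists>K. \<forall>i\<ge>K. x i = 0)"

definition shortest_len :: "nat \<Rightarrow> (nat \<Rightarrow> nat) \<Rightarrow> nat" where
  "shortest_len n x = card {i. 1 \<le> i \<and> x i = n}"

text \<open>One event of the uniformized chain (total event rate lam*n + n), driven by a
uniform mark u in [0,1]: with probability lam*n/(lam*n+n) an arrival joins a shortest
queue; otherwise a server index j in {0..n-1} is chosen uniformly (servers sorted by
decreasing queue length; the j-th longest queue has length card {i>=1. j < Q_i}) and,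
if that queue is nonempty, one of its customers departs.\<close>
definition jsq_step :: "nat \<Rightarrow> real \<Rightarrow> (nat \<Rightarrow> nat) \<Rightarrow> real \<Rightarrow> (nat \<Rightarrow> nat)" where
  "jsq_step n lam x u =
     (let a = u * (lam * real n + real n) in
      if a < lam * real n then
        (let m = shortest_len n x in x(m + 1 := Suc (x (m + 1))))
      else
        (let j = nat \<lfloor>a - lam * real n\<rfloor>;
             L = card {i. 1 \<le> i \<and> j < x i}
         in if 1 \<le> L then x(L := x L - 1) else x))"

primrec jsq_chain :: "nat \<Rightarrow> real \<Rightarrow> (nat \<Rightarrow> nat) \<Rightarrow> (nat \<Rightarrow> real) \<Rightarrow> nat \<Rightarrow> (nat \<Rightarrow> nat)" where
  "jsq_chain n lam x0 U 0 = x0"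
| "jsq_chain n lam x0 U (Suc m) = jsq_step n lam (jsq_chain n lam x0 U m) (U m)"

text \<open>Number of events in [0,t]; the m-th event happens at time E 0 + ... + E (m-1).\<close>
definition event_count :: "(nat \<Rightarrow> real) \<Rightarrow> real \<Rightarrow> nat" where
  "event_count E t = card {m. 1 \<le> m \<and> (\<Sum>l<m. E l) \<le> t}"

definition jsq_state ::
  "nat \<Rightarrow> real \<Rightarrow> (nat \<Rightarrow> nat) \<Rightarrow> (nat \<Rightarrow> real) \<Rightarrow> (nat \<Rightarrow> real) \<Rightarrow> real \<Rightarrow> (nat \<Rightarrow> nat)" where
  "jsq_state n lam x0 E U t = jsq_chain n lam x0 U (event_count E t)"

definition waiting :: "(nat \<Rightarrow> nat) \<Rightarrow> nat" where
  "waiting x = (\<Sum>i\<in>{i. 2 \<le> i \<and> 0 < x i}. x i)"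

text \<open>Sample space: initial state, i.i.d. Exp(lam*n+n) inter-event times, i.i.d.
uniform [0,1] marks, all independent.\<close>
definition jsq_space ::
  "nat \<Rightarrow> real \<Rightarrow> (nat \<Rightarrow> nat) pmf \<Rightarrow> ((nat \<Rightarrow> nat) \<times> (nat \<Rightarrow> real) \<times> (nat \<Rightarrow> real)) measure" where
  "jsq_space n lam init =
     measure_pmf init \<Otimes>\<^sub>M
       ((PiM UNIV (\<lambda>_. density lborel (exponential_density (lam * real n + real n)))) \<Otimes>\<^sub>M
        (PiM UNIV (\<lambda>_. uniform_measure lborel {0..1})))"

definition jsq_Z ::
  "nat \<Rightarrow> real \<Rightarrow> ((nat \<Rightarrow> nat) \<times> (nat \<Rightarrow> real) \<times> (nat \<Rightarrow> real)) \<Rightarrow> real \<Rightarrow> real" where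
  "jsq_Z n lam \<omega> t =
     integral {0..t} (\<lambda>s. real (waiting (jsq_state n lam (fst \<omega>) (fst (snd \<omega>)) (snd (snd \<omega>)) s)))"

text \<open>Scaled initial vector ((Q_1-n)/sqrt n, Q_2/sqrt n, ..., Q_k/sqrt n) as an element
of R^k, embedded into nat => real (coordinates j >= k are 0).\<close>
definition init_scaled :: "nat \<Rightarrow> nat \<Rightarrow> (nat \<Rightarrow> nat) \<Rightarrow> (nat \<Rightarrow> real)" where
  "init_scaled n k x = (\<lambda>j. if j = 0 then (real (x 1) - real n) / sqrt (real n)
                           else if j < k then real (x (j + 1)) / sqrt (real n) else 0)"

end

theory Submission
  imports Defs
begin

text \<open>
  Let \<open>I = n - Q\<^sub>1\<close> be the number of idle servers, \<open>W\<close> the number of waiting customers, and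
  \<open>G = (W - I) / sqrt n + 2 I\<^sup>2 / n + 1 \<ge> W / sqrt n\<close>.  The total number of customers
  \<open>n + W - I\<close> has drift \<open>I - n (1 - lam)\<close>, and \<open>I\<^sup>2 / n\<close> has drift at most
  \<open>2 + 2 b y - 2 y\<^sup>2\<close> with \<open>y = I / sqrt n\<close> and \<open>b = sqrt n (1 - lam)\<close>, so the generator
  applied to \<open>G\<close> is bounded by a constant depending only on \<open>b\<close>.  Hence the expectation of
  \<open>G\<close> grows at most linearly in the number of events of the uniformized chain.  The mean number of events up
  to time \<open>s\<close> is at most \<open>exp s\<close> times the event rate by a Chernoff bound, so Tonelli bounds the
  mean of \<open>Z\<^sub>t\<close> by a multiple of \<open>sqrt n\<close> on the event that \<open>G\<close> is initially bounded.  The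
  initial value of \<open>G\<close> is a continuous function of the scaled initial vector, hence tight, and
  Markov's inequality finishes the proof.
\<close>

subsection \<open>Combinatorics of a single event\<close>

text \<open>Since \<open>x\<close> is decreasing with finite support, the levels
  \<open>i >= 1\<close> with \<open>j < x i\<close> form an initial segment, so its cardinality, the
  length of the \<open>j\<close>-th longest queue, is also its last element. All comparisons of
  levels below go through this.\<close>

lemma level_le_iff:
  assumes "valid_state n x" "1 \<le> i"
  shows "i \<le> card {i. 1 \<le> i \<and> j < x i} \<longleftrightarrow> j < x i"
proof -
  let ?A = "{i. 1 \<le> i \<and> j < x i}"
  from assms obtain K where K: "\<And>i. i \<ge> K \<Longrightarrow> x i = 0" and anti: "antimono x"
    by (auto simp: valid_state_def)
  have "i < K" if "j < x i" for i using K[of i] that by (cases "i < K") auto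
  then have "?A \<subseteq> {..<K}" by auto
  then have fin: "finite ?A" by (rule finite_subset) simp
  show ?thesis
  proof
    assume "j < x i"
    then have "j < x l" if "l \<le> i" for l
      using antimonoD[OF anti that] by simp
    then have "{1..i} \<subseteq> ?A" by auto
    from card_mono[OF fin this] show "i \<le> card ?A" by simp
  next
    assume le: "i \<le> card ?A"
    show "j < x i"
    proof (rule ccontr)
      assume "\<not> j < x i"
      then have "l < i" if "j < x l" for l
        using antimonoD[OF anti, of i l] that by (cases "l < i") auto
      then have "?A \<subseteq> {1..<i}" by auto
      from card_mono[OF _ this] le \<open>1 \<le> i\<close> show False by simp
    qed
  qed
qed

lemma waiting_eq_sum:
  assumes "\<And>i. K \<le> i \<Longrightarrow> x i = 0"
  shows "waiting x = (\<Sum>i\<in>{2..<K}. x i)"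
proof -
  have "i < K" if "0 < x i" for i using assms[of i] that by (cases "i < K") auto
  then show ?thesis unfolding waiting_def by (intro sum.mono_neutral_left) auto
qed

text \<open>Additive form, so that one identity serves arrivals and departures without truncated
  subtraction.\<close>

lemma waiting_fun_upd:
  assumes "valid_state n x" "2 \<le> L"
  shows "waiting (x(L := v)) + x L = waiting x + v"
proof -
  from assms obtain K where K: "\<And>i. i \<ge> K \<Longrightarrow> x i = 0"
    by (auto simp: valid_state_def)
  \<comment> \<open>The range must contain \<open>L\<close> and reach past the support of both the
    old and the updated state.\<close>
  let ?K = "max K (Suc L)"
  have "waiting (x(L := v)) = (\<Sum>i\<in>{2..<?K}. (x(L := v)) i)"
    using K by (intro waiting_eq_sum) auto
  also have "\<dots> = v + (\<Sum>i\<in>{2..<?K} - {L}. (x(L := v)) i)"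
    using assms by (subst sum.remove[of _ L]) auto
  also have "(\<Sum>i\<in>{2..<?K} - {L}. (x(L := v)) i) = (\<Sum>i\<in>{2..<?K} - {L}. x i)"
    by (intro sum.cong) auto
  finally have 1: "waiting (x(L := v)) = v + (\<Sum>i\<in>{2..<?K} - {L}. x i)" .
  have "waiting x = (\<Sum>i\<in>{2..<?K}. x i)"
    using K by (intro waiting_eq_sum) auto
  also have "\<dots> = x L + (\<Sum>i\<in>{2..<?K} - {L}. x i)"
    using assms by (subst sum.remove[of _ L]) auto
  finally show ?thesis using 1 by simp
qed

lemma waiting_fun_upd_1: "waiting (x(Suc 0 := v)) = waiting x"
  unfolding waiting_def by (rule sum.cong) auto

text \<open>No level exceeds \<open>n\<close>, so a full level is one with
  \<open>n - 1 < x i\<close>. The shortest queue is thus the one of index \<open>n - 1\<close>, and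
  \<open>level_le_iff\<close> applies to it.\<close>

lemma shortest_len_eq:
  assumes "valid_state n x" "1 \<le> n"
  shows "shortest_len n x = card {i. 1 \<le> i \<and> n - 1 < x i}"
proof -
  have "x i \<le> n" for i
    using assms(1) by (auto simp: valid_state_def dest: antimonoD[of x 0 i])
  then have "{i. 1 \<le> i \<and> x i = n} = {i. 1 \<le> i \<and> n - 1 < x i}"
    using assms(2) by (auto intro!: antisym)
  then show ?thesis by (simp add: shortest_len_def)
qed

text \<open>The first two facts say that the level an arrival raises has room below a full level;
  the third says that an arrival finds an idle server exactly when one exists.\<close>

lemma shortest_len_props:
  assumes "valid_state n x" "1 \<le> n"
  shows "x (Suc (shortest_len n x)) < n" "x (shortest_len n x) = n"
    "shortest_len n x = 0 \<longleftrightarrow> x 1 < n"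
proof -
  let ?m = "shortest_len n x"
  have le: "x i \<le> n" for i
    using assms(1) by (auto simp: valid_state_def dest: antimonoD[of x 0 i])
  have iff: "i \<le> ?m \<longleftrightarrow> n - 1 < x i" if "1 \<le> i" for i
    using level_le_iff[OF assms(1) that] shortest_len_eq[OF assms] by simp
  show "x (Suc ?m) < n" using iff[of "Suc ?m"] assms(2) by simp
  show "x ?m = n"
  proof (cases "?m = 0")
    case True then show ?thesis using assms(1) by (simp add: valid_state_def)
  next
    case False then show ?thesis using iff[of ?m] le[of ?m] assms(2) by simp
  qed
  show "?m = 0 \<longleftrightarrow> x 1 < n" using iff[of 1] assms(2) by linarith
qed

lemma antimono_nat_iff: "antimono (x :: nat \<Rightarrow> nat) \<longleftrightarrow> (\<forall>i. x (Suc i) \<le> x i)"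
  by (auto simp: antimono_iff_le_Suc)

lemma valid_state_arrival:
  assumes v: "valid_state n x" and n: "1 \<le> n"
  shows "valid_state n (x(Suc (shortest_len n x) := Suc (x (Suc (shortest_len n x)))))"
proof -
  let ?m = "shortest_len n x"
  from v obtain K where K: "\<And>i. i \<ge> K \<Longrightarrow> x i = 0" by (auto simp: valid_state_def)
  have "x (Suc i) \<le> x i" for i using v by (auto simp: valid_state_def antimono_nat_iff)
  then have "antimono (x(Suc ?m := Suc (x (Suc ?m))))"
    using shortest_len_props(1,2)[OF assms] by (auto simp: antimono_nat_iff le_SucI)
  moreover have "\<exists>K. \<forall>i\<ge>K. (x(Suc ?m := Suc (x (Suc ?m)))) i = 0"
    using K by (intro exI[of _ "max K (Suc (Suc ?m))"]) auto
  ultimately show ?thesis using v by (auto simp: valid_state_def)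
qed

text \<open>\<open>L\<close> is the last level above \<open>j\<close>, so
  \<open>x (Suc L) <= j < x L\<close>, and lowering \<open>x L\<close> by one preserves the order;
  \<open>1 <= L\<close> protects \<open>x 0 = n\<close>.\<close>

lemma valid_state_departure:
  assumes v: "valid_state n x" and L: "L = card {i. 1 \<le> i \<and> j < x i}" "1 \<le> L"
  shows "valid_state n (x(L := x L - 1))"
proof -
  from v obtain K where K: "\<And>i. i \<ge> K \<Longrightarrow> x i = 0" by (auto simp: valid_state_def)
  have "x (Suc L) < x L"
    using level_le_iff[OF v, of L j] level_le_iff[OF v, of "Suc L" j] L by auto
  moreover have le: "x (Suc i) \<le> x i" for i using v by (auto simp: valid_state_def antimono_nat_iff)
  ultimately have "(x(L := x L - 1)) (Suc i) \<le> (x(L := x L - 1)) i" for i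
    using le[of i] by (cases "i = L"; cases "Suc i = L") auto
  then have "antimono (x(L := x L - 1))"
    by (simp add: antimono_nat_iff)
  moreover have "\<exists>K. \<forall>i\<ge>K. (x(L := x L - 1)) i = 0"
    using K by (intro exI[of _ K]) auto
  ultimately show ?thesis using v L by (auto simp: valid_state_def)
qed

lemma valid_state_step:
  assumes v: "valid_state n x" and n: "1 \<le> n"
  shows "valid_state n (jsq_step n lam x u)"
  unfolding jsq_step_def Let_def
  using valid_state_arrival[OF v n] valid_state_departure[OF v refl] v by simp

subsection \<open>Measurability\<close>

lemma pred_less_nat:
  fixes f g :: "'a \<Rightarrow> nat"
  assumes f: "f \<in> M \<rightarrow>\<^sub>M count_space UNIV" and g: "g \<in> M \<rightarrow>\<^sub>M count_space UNIV"
  shows "Measurable.pred M (\<lambda>w. f w < g w)"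
  by (rule measurable_compose_countable[OF _ f], rule measurable_compose[OF g]) simp

text \<open>Measurability of states is expressed coordinate by coordinate: a step changes a single
  coordinate, whose index is itself a measurable function with countable range.\<close>

lemma measurable_jsq_step:
  assumes X: "\<And>i. (\<lambda>w. X w i) \<in> M \<rightarrow>\<^sub>M count_space UNIV"
    and u[measurable]: "u \<in> borel_measurable M"
  shows "(\<lambda>w. jsq_step n lam (X w) (u w) i) \<in> M \<rightarrow>\<^sub>M count_space UNIV"
proof -
  define J where "J w = nat \<lfloor>u w * (lam * real n + real n) - lam * real n\<rfloor>" for w
  define L where "L w = card {i. 1 \<le> i \<and> J w < X w i}" for w
  have J: "J \<in> M \<rightarrow>\<^sub>M count_space UNIV" unfolding J_def by measurable
  note pred_less_nat[OF J X, measurable]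
  have [measurable]: "L \<in> M \<rightarrow>\<^sub>M count_space UNIV" unfolding L_def by (rule measurable_card) simp
  have [measurable]: "(\<lambda>w. shortest_len n (X w)) \<in> M \<rightarrow>\<^sub>M count_space UNIV"
    unfolding shortest_len_def using X by (intro measurable_card) simp
  have [measurable]: "(\<lambda>w. X w i) \<in> M \<rightarrow>\<^sub>M count_space UNIV" by (rule X)
  have "(\<lambda>w. jsq_step n lam (X w) (u w) i) =
    (\<lambda>w. if u w * (lam * real n + real n) < lam * real n
         then (if i = shortest_len n (X w) + 1 then Suc (X w i) else X w i)
         else (if 1 \<le> L w \<and> i = L w then X w i - 1 else X w i))"
    by (auto simp: jsq_step_def Let_def L_def J_def fun_eq_iff)
  also have "\<dots> \<in> M \<rightarrow>\<^sub>M count_space UNIV" by measurable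
  finally show ?thesis .
qed

lemma measurable_jsq_chain:
  assumes X[measurable]: "\<And>i. (\<lambda>w. X w i) \<in> M \<rightarrow>\<^sub>M count_space UNIV"
    and U[measurable]: "\<And>m. (\<lambda>w. U w m) \<in> borel_measurable M"
  shows "(\<lambda>w. jsq_chain n lam (X w) (U w) m i) \<in> M \<rightarrow>\<^sub>M count_space UNIV"
proof (induction m arbitrary: i)
  case (Suc m)
  then show ?case unfolding jsq_chain.simps by (intro measurable_jsq_step U)
qed simp

text \<open>The index set in \<open>waiting\<close> varies with the state. On eventually vanishing
  states the sum is a series over fixed indices; on all others the index set is infinite and
  \<open>sum\<close> returns 0.\<close>

lemma measurable_waiting:
  assumes X[measurable]: "\<And>i. (\<lambda>w. X w i) \<in> M \<rightarrow>\<^sub>M count_space UNIV"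
  shows "(\<lambda>w. real (waiting (X w))) \<in> borel_measurable M"
proof -
  have "real (waiting x) =
      (if \<exists>K. \<forall>i\<ge>K. x i = 0 then (\<Sum>i. if 2 \<le> i then real (x i) else 0) else 0)"
    for x :: "nat \<Rightarrow> nat"
  proof (cases "\<exists>K. \<forall>i\<ge>K. x i = 0")
    case True
    then obtain K where K: "\<And>i. i \<ge> K \<Longrightarrow> x i = 0" by auto
    have "(\<Sum>i. if 2 \<le> i then real (x i) else 0) = (\<Sum>i\<in>{2..<K}. real (x i))"
      using K by (subst suminf_finite[of "{2..<K}"]) auto
    with True waiting_eq_sum[OF K] show ?thesis by simp
  next
    case False
    have "infinite {i. 2 \<le> i \<and> 0 < x i}"
    proof
      assume "finite {i. 2 \<le> i \<and> 0 < x i}"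
      then obtain b where b: "\<And>i. 2 \<le> i \<Longrightarrow> 0 < x i \<Longrightarrow> i \<le> b"
        by (auto simp: finite_nat_set_iff_bounded_le)
      have "\<forall>i\<ge>b + 2. x i = 0"
      proof (intro allI impI)
        fix i assume "b + 2 \<le> i"
        then show "x i = 0" using b[of i] by (cases "x i") auto
      qed
      with False show False by blast
    qed
    then have "waiting x = 0" by (simp add: waiting_def)
    with False show ?thesis by (simp only: if_False)
  qed
  then have "(\<lambda>w. real (waiting (X w))) = (\<lambda>w. if \<exists>K. \<forall>i\<ge>K. X w i = 0 then (\<Sum>i. if 2 \<le> i then real (X w i) else 0) else 0)"
    by (intro ext)
  also have "\<dots> \<in> borel_measurable M" by measurable
  finally show ?thesis .
qed

lemma measurable_event_count:
  assumes E[measurable]: "\<And>m. (\<lambda>w. E w m) \<in> borel_measurable M"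
    and s[measurable]: "s \<in> borel_measurable M"
  shows "(\<lambda>w. event_count (E w) (s w)) \<in> M \<rightarrow>\<^sub>M count_space UNIV"
  unfolding event_count_def by measurable

lemma measurable_jsq_state:
  assumes X: "\<And>i. (\<lambda>w. X w i) \<in> M \<rightarrow>\<^sub>M count_space UNIV"
    and E: "\<And>m. (\<lambda>w. E w m) \<in> borel_measurable M"
    and U: "\<And>m. (\<lambda>w. U w m) \<in> borel_measurable M"
    and s: "s \<in> borel_measurable M"
  shows "(\<lambda>w. jsq_state n lam (X w) (E w) (U w) (s w) i) \<in> M \<rightarrow>\<^sub>M count_space UNIV"
  unfolding jsq_state_def
  by (rule measurable_compose_countable[OF measurable_jsq_chain[OF X U] measurable_event_count[OF E s]])

text \<open>Turns the gauge integral of \<open>jsq_Z\<close> into a Lebesgue integral, to which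
  Tonelli applies. Without integrability both sides take the value 0, the left by convention and the
  right because \<open>enn2real\<close> maps infinity to 0.\<close>

lemma integral_eq_enn2real_nn_integral:
  fixes f :: "real \<Rightarrow> real"
  assumes f[measurable]: "f \<in> borel_measurable borel" and nn: "\<And>x. 0 \<le> f x"
    and S[measurable]: "S \<in> sets borel"
  shows "integral S f = enn2real (\<integral>\<^sup>+x. ennreal (f x) * indicator S x \<partial>lborel)"
proof (cases "f integrable_on S")
  case True
  then have "(f has_integral integral S f) S" by (rule integrable_integral)
  from nn_integral_has_integral_lebesgue'[OF nn this] integral_nonneg[OF True] nn
  show ?thesis by simp
next
  case False
  have "(\<integral>\<^sup>+x. ennreal (f x) * indicator S x \<partial>lborel) = \<infinity>"
  proof (rule ccontr)
    assume "\<not> ?thesis"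
    then have "(\<integral>\<^sup>+x. ennreal (f x * indicator S x) \<partial>lborel) < \<infinity>"
      by (simp add: ennreal_mult'' ennreal_indicator less_top)
    then have "(\<lambda>x. f x * indicator S x) integrable_on UNIV"
      using nn by (intro nn_integral_integrable_on) auto
    also have "(\<lambda>x. f x * indicator S x) = (\<lambda>x. if x \<in> S then f x else 0)" by auto
    finally have "f integrable_on S" by (simp add: integrable_restrict_UNIV)
    with False show False by simp
  qed
  with False show ?thesis by (simp add: not_integrable_integral)
qed

subsection \<open>Drift of the potential\<close>

text \<open>The scaled customer count alone has drift \<open>y - b\<close>, unbounded in the scaled
  idle count \<open>y\<close>. The quadratic term contributes a drift of order
  \<open>- 4 * y^2\<close> that compensates, and together with the constant 1 it dominates the
  negative term \<open>- y\<close>.\<close>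

definition potential :: "nat \<Rightarrow> (nat \<Rightarrow> nat) \<Rightarrow> real" where
  "potential n x = (real (waiting x) - (real n - real (x 1))) / sqrt (real n)
     + 2 * ((real n - real (x 1)) / sqrt (real n))\<^sup>2 + 1"

lemma potential_ge_waiting: "real (waiting x) / sqrt (real n) \<le> potential n x"
proof -
  define y where "y = (real n - real (x 1)) / sqrt (real n)"
  \<comment> \<open>The right side equals \<open>4 * y^2 - 2 * y + 1\<close>, which is below twice
    the wanted \<open>2 * y^2 - y + 1\<close>.\<close>
  have "0 \<le> (y - 1)\<^sup>2 + y\<^sup>2 * 3" by simp
  then have "0 \<le> 2 * y\<^sup>2 - y + 1" by (simp add: power2_eq_square algebra_simps)
  then show ?thesis
    by (simp add: potential_def y_def diff_divide_distrib)
qed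

lemma potential_nonneg: "0 \<le> potential n x"
  using potential_ge_waiting[of x n] by (rule order_trans[rotated]) simp

lemma measurable_potential:
  assumes X: "\<And>i. (\<lambda>w. X w i) \<in> M \<rightarrow>\<^sub>M count_space UNIV"
  shows "(\<lambda>w. potential n (X w)) \<in> borel_measurable M"
proof -
  note measurable_waiting[OF X, measurable]
  have [measurable]: "(\<lambda>w. X w (Suc 0)) \<in> M \<rightarrow>\<^sub>M count_space UNIV" by (rule X)
  show ?thesis unfolding potential_def by simp
qed

text \<open>The customer count rises by one in either case. If a server is idle, \<open>I\<close>
  drops by one and \<open>(I - 1)^2 - I^2 = 1 - 2 * I\<close> gives equality; otherwise
  \<open>I = 0\<close>, the quadratic term stays put, and the bound holds with slack
  \<open>2 / n\<close>.\<close>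

lemma potential_arrival_le:
  assumes v: "valid_state n x" and n: "1 \<le> n"
  shows "potential n (x(Suc (shortest_len n x) := Suc (x (Suc (shortest_len n x)))))
    \<le> potential n x + 1 / sqrt (real n) + 2 * (1 - 2 * (real n - real (x 1))) / real n"
proof (cases "shortest_len n x = 0")
  case True
  with n show ?thesis
    by (simp add: potential_def waiting_fun_upd_1 power_divide divide_simps)
       (simp add: algebra_simps power2_eq_square)
next
  case False
  let ?L = "Suc (shortest_len n x)"
  have "x 1 \<le> n" using v by (auto simp: valid_state_def dest: antimonoD[of x 0 1])
  then have x1: "x (Suc 0) = n" using shortest_len_props(3)[OF v n] False by simp
  have "waiting (x(?L := Suc (x ?L))) = Suc (waiting x)"
    using waiting_fun_upd[OF v, of ?L "Suc (x ?L)"] False by simp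
  with False n x1 show ?thesis
    by (simp add: potential_def field_simps)
qed

lemma potential_departure_1:
  assumes "1 \<le> n" "0 < x 1"
  shows "potential n (x(1 := x 1 - 1))
    = potential n x - 1 / sqrt (real n) + 2 * (1 + 2 * (real n - real (x 1))) / real n"
  using assms
  by (simp add: potential_def waiting_fun_upd_1 power_divide divide_simps of_nat_diff)
     (simp add: algebra_simps power2_eq_square)

lemma potential_departure_ge_2:
  assumes "valid_state n x" "1 \<le> n" "2 \<le> L" "0 < x L"
  shows "potential n (x(L := x L - 1)) = potential n x - 1 / sqrt (real n)"
proof -
  have "real (waiting (x(L := x L - 1))) = real (waiting x) - 1"
    using waiting_fun_upd[OF assms(1,3), of "x L - 1"] assms(4) by linarith
  with assms show ?thesis by (simp add: potential_def diff_divide_distrib)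
qed

text \<open>Cuts the range of the mark into arrival, departure from a queue of length at least 2,
  departure from a queue of length 1, and no change. Longest queues come first, so the cuts are at
  \<open>x 2\<close> and \<open>x 1\<close>. Overlapping endpoints only enlarge the bound, as all
  terms are nonnegative.\<close>

lemma potential_jsq_step_le:
  assumes v: "valid_state n x" and n: "1 \<le> n" and lam: "0 < lam"
    and u: "0 \<le> u" "u \<le> 1"
  defines "mu \<equiv> lam * real n + real n"
  defines "p0 \<equiv> lam * real n / mu" and "p2 \<equiv> (lam * real n + real (x 2)) / mu"
    and "p1 \<equiv> (lam * real n + real (x 1)) / mu"
  shows "ennreal (potential n (jsq_step n lam x u)) \<le>
     ennreal (potential n (x(Suc (shortest_len n x) := Suc (x (Suc (shortest_len n x)))))) * indicator {0..p0} u
   + ennreal (potential n x - 1 / sqrt (real n)) * indicator {p0..p2} u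
   + ennreal (potential n (x(1 := x 1 - 1))) * indicator {p2..p1} u
   + ennreal (potential n x) * indicator {p1..1} u"
proof -
  have mu: "0 < mu" using n lam by (simp add: mu_def add_pos_pos)
  define j where "j = nat \<lfloor>u * mu - lam * real n\<rfloor>"
  define L where "L = card {i. 1 \<le> i \<and> j < x i}"
  have L1: "1 \<le> L \<longleftrightarrow> j < x 1" and L2: "2 \<le> L \<longleftrightarrow> j < x 2"
    unfolding L_def by (rule level_le_iff[OF v]; simp)+
  show ?thesis
  proof (cases "u * mu < lam * real n")
    case True
    then have "u \<le> p0" using mu by (simp add: p0_def field_simps)
    moreover have "jsq_step n lam x u = x(Suc (shortest_len n x) := Suc (x (Suc (shortest_len n x))))"
      using True by (simp add: jsq_step_def Let_def mu_def)
    ultimately show ?thesis using u by (simp add: add_increasing2)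
  next
    case False
    then have step: "jsq_step n lam x u = (if 1 \<le> L then x(L := x L - 1) else x)"
      by (simp add: jsq_step_def Let_def mu_def j_def L_def)
    \<comment> \<open>In the departure case the argument of the floor is nonnegative, so
      \<open>nat\<close> does not truncate.\<close>
    have jlt: "j < k \<longleftrightarrow> u * mu - lam * real n < real k" for k
      using False unfolding j_def by linarith
    consider "2 \<le> L" | "L = 1" | "L = 0" by linarith
    then show ?thesis
    proof cases
      case 1
      then have "u \<in> {p0..p2}" using L2 jlt[of "x 2"] False mu by (simp add: p0_def p2_def field_simps)
      moreover have "0 < x L"
        using level_le_iff[OF v, of L j] 1 by (simp only: L_def[symmetric]) simp
      then have "potential n (jsq_step n lam x u) = potential n x - 1 / sqrt (real n)"
        using step 1 potential_departure_ge_2[OF v n 1] by simp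
      ultimately show ?thesis by (simp add: add_increasing add_increasing2)
    next
      case 2
      then have "u \<in> {p2..p1}" using L1 L2 jlt[of "x 1"] jlt[of "x 2"] mu by (simp add: p1_def p2_def field_simps)
      then show ?thesis using step 2 by (simp add: add_increasing add_increasing2)
    next
      case 3
      then have "u \<in> {p1..1}" using L1 jlt[of "x 1"] mu u by (simp add: p1_def field_simps)
      then show ?thesis using step 3 by (simp add: add_increasing add_increasing2)
    qed
  qed
qed

section \<open>Expectation of the potential over one event and over many events\<close>

abbreviation unif01 :: "real measure" where
  "unif01 \<equiv> uniform_measure lborel {0..1}"

lemma prob_space_unif01: "prob_space unif01"
  by (rule prob_space_uniform_measure) simp_all

text \<open>Depends on \<open>n\<close> and \<open>lam\<close> only through
  \<open>b = sqrt n * (1 - lam)\<close>, hence stays bounded in heavy traffic.\<close>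

definition drift_bound :: "nat \<Rightarrow> real \<Rightarrow> real" where
  "drift_bound n lam = 4 + (1 + 4 * (sqrt (real n) * (1 - lam)))\<^sup>2"

lemma drift_bound_nonneg: "0 \<le> drift_bound n lam"
  by (simp add: drift_bound_def)

text \<open>The left side bounds the generator applied to the potential: jump rates
  \<open>l * N\<close>, \<open>x2\<close> and \<open>x1 - x2\<close>, each times the change of the
  potential, with \<open>r\<close> standing for \<open>sqrt N\<close>.\<close>

lemma potential_drift_algebra:
  fixes N r I l x1 x2 :: real
  assumes r: "0 < r" "r * r = N" and I: "0 \<le> I" "x1 = N - I" and x2: "0 \<le> x2" and x1: "0 \<le> x1"
    and l: "0 < l" "l < 1"
  shows "l * N * (1 / r + 2 * (1 - 2 * I) / N) + x2 * (- 1 / r)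
     + (x1 - x2) * (- 1 / r + 2 * (1 + 2 * I) / N) \<le> 4 + (1 + 4 * (r * (1 - l)))\<^sup>2"
proof -
  define y b where "y = I / r" and "b = r * (1 - l)"
  have Ny: "I = y * r" and y0: "0 \<le> y" using r I by (auto simp: y_def)
  have b0: "0 \<le> b" using r l by (simp add: b_def)
  have N: "0 < N" using r by auto
  have "l * N * (1 / r + 2 * (1 - 2 * I) / N) + x2 * (- 1 / r)
     + (x1 - x2) * (- 1 / r + 2 * (1 + 2 * I) / N)
     = (l * N - x1) / r + 2 * l * (1 - 2 * I) + (x1 - x2) * (2 * (1 + 2 * I) / N)"
    using N r(1) by (simp add: field_simps)
  \<comment> \<open>\<open>x2\<close> enters with a negative coefficient and is dropped.\<close>
  also have "\<dots> \<le> (l * N - x1) / r + 2 * l * (1 - 2 * I) + x1 * (2 * (1 + 2 * I) / N)"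
    using x2 N I by (intro add_left_mono mult_right_mono) auto
  also have "(l * N - x1) / r = y - b"
    using r I by (simp add: y_def b_def field_simps)
  also have "x1 * (2 * (1 + 2 * I) / N) = 2 + 4 * I - 2 * I / N - 4 * y\<^sup>2"
  proof -
    have "I\<^sup>2 / N = y\<^sup>2" using r by (simp add: y_def power_divide power2_eq_square)
    moreover have "x1 * (2 * (1 + 2 * I) / N) = 2 + 4 * I - 2 * I / N - 4 * (I\<^sup>2 / N)"
      unfolding I(2) using N by (simp add: field_simps power2_eq_square)
    ultimately show ?thesis by simp
  qed
  \<comment> \<open>The large terms \<open>4 * I\<close> from services and
    \<open>- 4 * l * I\<close> from arrivals nearly cancel: what remains is
    \<open>4 * I * (1 - l) = 4 * b * y\<close>.\<close>
  also have "y - b + 2 * l * (1 - 2 * I) + (2 + 4 * I - 2 * I / N - 4 * y\<^sup>2)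
      = y - b + 2 * l + 4 * (b * y) + 2 - 2 * I / N - 4 * y\<^sup>2"
    using r(1) by (simp add: b_def y_def field_simps)
  also have "\<dots> \<le> y + 4 + 4 * (b * y) - 4 * y\<^sup>2"
  proof -
    have "0 \<le> 2 * I / N" using I N by simp
    then show ?thesis using b0 l by linarith
  qed
  \<comment> \<open>With \<open>c = 1 + 4 * b\<close> the claim is
    \<open>c * y - 4 * y^2 <= c^2\<close>; the sum below equals
    \<open>c^2 - c * y + 4 * y^2\<close>.\<close>
  also have "\<dots> \<le> 4 + (1 + 4 * b)\<^sup>2"
  proof -
    have "0 \<le> ((1 + 4 * b) - y)\<^sup>2 + 3 * y\<^sup>2 + (1 + 4 * b) * y"
      using b0 y0 by (intro add_nonneg_nonneg) auto
    then show ?thesis by (simp add: power2_eq_square algebra_simps)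
  qed
  finally show ?thesis by (simp add: b_def)
qed

text \<open>Integrates the partition bound over the mark. The generator is divided by the total
  event rate because one event of the uniformized chain is considered.\<close>

lemma nn_integral_potential_step:
  assumes v: "valid_state n x" and n: "1 \<le> n" and lam: "0 < lam" "lam < 1"
  shows "(\<integral>\<^sup>+u. ennreal (potential n (jsq_step n lam x u)) \<partial>unif01)
    \<le> ennreal (potential n x + drift_bound n lam / (lam * real n + real n))"
proof -
  define mu where "mu = lam * real n + real n"
  have mu: "0 < mu" using n lam by (simp add: mu_def add_pos_pos)
  define p0 p2 p1 where "p0 = lam * real n / mu" and "p2 = (lam * real n + real (x 2)) / mu"
    and "p1 = (lam * real n + real (x 1)) / mu"
  have x21: "x 2 \<le> x 1" and x1n: "x 1 \<le> n"
    using v by (auto simp: valid_state_def dest: antimonoD[of x 1 2] antimonoD[of x 0 1])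
  have p: "0 \<le> p0" "p0 \<le> p2" "p2 \<le> p1" "p1 \<le> 1"
    using mu lam n x21 x1n by (auto simp: p0_def p2_def p1_def divide_simps mu_def)
  define G GA GW GI where "G = potential n x"
    and "GA = potential n (x(Suc (shortest_len n x) := Suc (x (Suc (shortest_len n x)))))"
    and "GW = potential n x - 1 / sqrt (real n)" and "GI = potential n (x(1 := x 1 - 1))"
  have nonneg: "0 \<le> G" "0 \<le> GA" "0 \<le> GI" by (simp_all add: G_def GA_def GI_def potential_nonneg)
  \<comment> \<open>\<open>ennreal\<close> truncates a negative \<open>GW\<close> to 0. That can
    happen only if \<open>x 2 = 0\<close>, and then the interval has length 0.\<close>
  have GW: "(p2 - p0) * max 0 GW = (p2 - p0) * GW"
  proof (cases "x 2 = 0")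
    case False
    then have "0 \<le> GW"
      using potential_departure_ge_2[OF v n, of 2] potential_nonneg[of n "x(2 := x 2 - 1)"]
      by (simp add: GW_def)
    then show ?thesis by simp
  qed (simp add: p2_def p0_def)
  \<comment> \<open>The formula for \<open>GI\<close> needs a busy server; otherwise the weight
    \<open>x 1 - x 2\<close> vanishes.\<close>
  have GI: "(real (x 1) - real (x 2)) * (GI - G) = (real (x 1) - real (x 2)) * (- 1 / sqrt (real n) + 2 * (1 + 2 * (real n - real (x 1))) / real n)"
  proof (cases "x 1 = 0")
    case False
    then show ?thesis
      using potential_departure_1[OF n, of x] by (simp add: GI_def G_def)
  qed (use x21 in simp)
  note [measurable] = measurable_potential[OF measurable_jsq_step[of "\<lambda>_. x" borel "\<lambda>u. u" n lam]]
  have "(\<integral>\<^sup>+u. ennreal (potential n (jsq_step n lam x u)) \<partial>unif01)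
      = (\<integral>\<^sup>+u. ennreal (potential n (jsq_step n lam x u)) * indicator {0..1} u \<partial>lborel)"
    by (subst nn_integral_uniform_measure) (auto simp: divide_ennreal_def)
  also have "\<dots> \<le> (\<integral>\<^sup>+u. ennreal GA * indicator {0..p0} u + ennreal GW * indicator {p0..p2} u
       + ennreal GI * indicator {p2..p1} u + ennreal G * indicator {p1..1} u \<partial>lborel)"
  proof (intro nn_integral_mono)
    fix u :: real
    show "ennreal (potential n (jsq_step n lam x u)) * indicator {0..1} u
      \<le> ennreal GA * indicator {0..p0} u + ennreal GW * indicator {p0..p2} u
       + ennreal GI * indicator {p2..p1} u + ennreal G * indicator {p1..1} u"
      using potential_jsq_step_le[OF v n lam(1), of u]
      by (cases "u \<in> {0..1}") (auto simp: mu_def p0_def p1_def p2_def G_def GA_def GW_def GI_def)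
  qed
  also have "\<dots> = ennreal GA * ennreal p0 + ennreal GW * ennreal (p2 - p0)
       + ennreal GI * ennreal (p1 - p2) + ennreal G * ennreal (1 - p1)"
    using p by (simp add: nn_integral_add nn_integral_cmult_indicator)
  also have "\<dots> = ennreal (GA * p0) + ennreal (max 0 GW * (p2 - p0))
       + ennreal (GI * (p1 - p2)) + ennreal (G * (1 - p1))"
    using p nonneg by (simp add: ennreal_mult'' ennreal_max_0)
  also have "\<dots> = ennreal (GA * p0 + max 0 GW * (p2 - p0) + GI * (p1 - p2) + G * (1 - p1))"
    using p nonneg by (simp add: ennreal_plus)
  also have "\<dots> \<le> ennreal (G + drift_bound n lam / mu)"
  proof (rule ennreal_leI)
    have "GA * p0 + max 0 GW * (p2 - p0) + GI * (p1 - p2) + G * (1 - p1)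
      = GA * p0 + GW * (p2 - p0) + GI * (p1 - p2) + G * (1 - p1)"
      using GW by (simp add: mult.commute)
    also have "\<dots> = G + (lam * real n * (GA - G) + real (x 2) * (GW - G) + (real (x 1) - real (x 2)) * (GI - G)) / mu"
      using mu by (simp add: p0_def p1_def p2_def divide_simps) (simp add: algebra_simps)
    also have "\<dots> \<le> G + drift_bound n lam / mu"
    proof (intro add_left_mono divide_right_mono)
      have "lam * real n * (GA - G) + real (x 2) * (GW - G) + (real (x 1) - real (x 2)) * (GI - G)
        \<le> lam * real n * (1 / sqrt (real n) + 2 * (1 - 2 * (real n - real (x 1))) / real n)
          + real (x 2) * (- 1 / sqrt (real n))
          + (real (x 1) - real (x 2)) * (- 1 / sqrt (real n) + 2 * (1 + 2 * (real n - real (x 1))) / real n)"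
      proof (intro add_mono)
        have "GA - G \<le> 1 / sqrt (real n) + 2 * (1 - 2 * (real n - real (x 1))) / real n"
          using potential_arrival_le[OF v n] by (simp add: GA_def G_def)
        then show "lam * real n * (GA - G)
          \<le> lam * real n * (1 / sqrt (real n) + 2 * (1 - 2 * (real n - real (x 1))) / real n)"
          using lam by (intro mult_left_mono) auto
        show "(real (x 1) - real (x 2)) * (GI - G) \<le>
          (real (x 1) - real (x 2)) * (- 1 / sqrt (real n) + 2 * (1 + 2 * (real n - real (x 1))) / real n)"
          by (rule eq_refl[OF GI])
      qed (simp add: GW_def G_def)
      also have "\<dots> \<le> drift_bound n lam"
        unfolding drift_bound_def
        using n x1n lam by (intro potential_drift_algebra) auto
      finally show "lam * real n * (GA - G) + real (x 2) * (GW - G) + (real (x 1) - real (x 2)) * (GI - G)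
        \<le> drift_bound n lam" .
    qed (use mu in simp)
    finally show "GA * p0 + max 0 GW * (p2 - p0) + GI * (p1 - p2) + G * (1 - p1) \<le> G + drift_bound n lam / mu" .
  qed
  finally show ?thesis by (simp add: G_def mu_def)
qed

text \<open>Splits the first coordinate off an i.i.d. sequence, the rest being again such a
  sequence. It drives the inductions over the marks and over the event times.\<close>

lemma nn_integral_PiM_nat_split:
  assumes M: "prob_space M"
    and f: "f \<in> borel_measurable (PiM (UNIV :: nat set) (\<lambda>_. M))"
  shows "(\<integral>\<^sup>+w. f w \<partial>PiM UNIV (\<lambda>_. M)) = (\<integral>\<^sup>+s. \<integral>\<^sup>+w. f (case_nat s w) \<partial>PiM UNIV (\<lambda>_. M) \<partial>M)"
proof -
  interpret M: prob_space M by fact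
  interpret sequence_space M by unfold_locales
  interpret P: prob_space "PiM (UNIV :: nat set) (\<lambda>_. M)"
    by (rule prob_space_PiM) (rule M)
  have m: "(\<lambda>(s, w). case_nat s w) \<in> M \<Otimes>\<^sub>M S \<rightarrow>\<^sub>M S" by measurable
  have "(\<integral>\<^sup>+w. f w \<partial>S) = (\<integral>\<^sup>+w. f w \<partial>distr (M \<Otimes>\<^sub>M S) S (\<lambda>(s, w). case_nat s w))"
    by (simp add: PiM_iter)
  also have "\<dots> = (\<integral>\<^sup>+p. f (case p of (s, w) \<Rightarrow> case_nat s w) \<partial>(M \<Otimes>\<^sub>M S))"
    using f by (intro nn_integral_distr m) simp
  also have "\<dots> = (\<integral>\<^sup>+s. \<integral>\<^sup>+w. f (case_nat s w) \<partial>S \<partial>M)"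
    using measurable_compose[OF m f] by (subst P.nn_integral_fst[symmetric]) (auto simp: split_beta')
  finally show ?thesis .
qed

text \<open>The recursion of \<open>jsq_chain\<close> peels off the last event; this peels off the
  first, as conditioning on the first mark requires.\<close>

lemma jsq_chain_case_nat:
  "jsq_chain n lam x (case_nat u U) (Suc m) = jsq_chain n lam (jsq_step n lam x u) U m"
  by (induction m) simp_all

lemma measurable_component_unif01:
  "(\<lambda>U. U m) \<in> borel_measurable (PiM (UNIV :: nat set) (\<lambda>_. unif01))"
  by (rule measurable_compose[OF measurable_component_singleton]) auto

text \<open>First-step analysis: the remaining marks drive a chain started from
  \<open>jsq_step n lam x u\<close>, so the induction is over arbitrary valid starting
  states.\<close>

lemma nn_integral_potential_chain:
  assumes v: "valid_state n x" and n: "1 \<le> n" and lam: "0 < lam" "lam < 1"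
  shows "(\<integral>\<^sup>+U. ennreal (potential n (jsq_chain n lam x U m)) \<partial>PiM UNIV (\<lambda>_. unif01))
    \<le> ennreal (potential n x + real m * (drift_bound n lam / (lam * real n + real n)))"
  using v
proof (induction m arbitrary: x)
  case 0
  interpret prob_space "PiM (UNIV :: nat set) (\<lambda>_. unif01)"
    by (rule prob_space_PiM) (rule prob_space_unif01)
  show ?case by (simp add: emeasure_space_1)
next
  case (Suc m)
  interpret prob_space unif01 by (rule prob_space_unif01)
  let ?d = "drift_bound n lam / (lam * real n + real n)"
  have d: "0 \<le> ?d" using lam by (simp add: drift_bound_nonneg)
  have meas: "(\<lambda>U. ennreal (potential n (jsq_chain n lam x U (Suc m)))) \<in> borel_measurable (PiM UNIV (\<lambda>_. unif01))"
    using measurable_potential[OF measurable_jsq_chain[of "\<lambda>_. x" "PiM UNIV (\<lambda>_. unif01)" "\<lambda>U. U" n lam "Suc m"], of n]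
      measurable_component_unif01
    by (auto simp del: jsq_chain.simps)
  have meas': "(\<lambda>u. ennreal (potential n (jsq_step n lam x u))) \<in> borel_measurable unif01"
    using measurable_potential[OF measurable_jsq_step[of "\<lambda>_. x" borel "\<lambda>u. u" n lam]]
    by simp
  have "(\<integral>\<^sup>+U. ennreal (potential n (jsq_chain n lam x U (Suc m))) \<partial>PiM UNIV (\<lambda>_. unif01))
    = (\<integral>\<^sup>+u. \<integral>\<^sup>+U. ennreal (potential n (jsq_chain n lam (jsq_step n lam x u) U m)) \<partial>PiM UNIV (\<lambda>_. unif01) \<partial>unif01)"
    unfolding jsq_chain_case_nat[symmetric]
    by (rule nn_integral_PiM_nat_split[OF prob_space_unif01 meas])
  also have "\<dots> \<le> (\<integral>\<^sup>+u. ennreal (potential n (jsq_step n lam x u) + real m * ?d) \<partial>unif01)"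
    by (intro nn_integral_mono Suc.IH valid_state_step Suc.prems n)
  also have "\<dots> = (\<integral>\<^sup>+u. ennreal (potential n (jsq_step n lam x u)) + ennreal (real m * ?d) \<partial>unif01)"
    using d by (intro nn_integral_cong ennreal_plus potential_nonneg mult_nonneg_nonneg) auto
  also have "\<dots> = (\<integral>\<^sup>+u. ennreal (potential n (jsq_step n lam x u)) \<partial>unif01) + ennreal (real m * ?d)"
    by (subst nn_integral_add[OF meas']) (auto simp: emeasure_space_1[simplified])
  also have "\<dots> \<le> ennreal (potential n x + ?d) + ennreal (real m * ?d)"
    by (intro add_right_mono nn_integral_potential_step Suc.prems n lam)
  also have "\<dots> = ennreal (potential n x + real (Suc m) * ?d)"
    using d by (subst ennreal_plus[symmetric])
      (auto intro!: add_nonneg_nonneg mult_nonneg_nonneg potential_nonneg simp: distrib_right add.assoc simp del: times_divide_eq_right)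
  finally show ?case .
qed

subsection \<open>Number of events\<close>

abbreviation exp_distr :: "real \<Rightarrow> real measure" where
  "exp_distr mu \<equiv> density lborel (exponential_density mu)"

text \<open>Exponential tilting: \<open>exp (- e)\<close> times the density of rate
  \<open>mu\<close> is \<open>mu / (mu + 1)\<close> times the density of rate \<open>mu + 1\<close>,
  which has mass 1.\<close>

lemma nn_integral_exp_neg_exp_distr:
  assumes mu: "0 < mu"
  shows "(\<integral>\<^sup>+e. ennreal (exp (- e)) \<partial>exp_distr mu) = ennreal (mu / (mu + 1))"
proof -
  interpret P: prob_space "exp_distr (mu + 1)"
    using mu by (intro prob_space_exponential_density) simp
  have "(\<integral>\<^sup>+e. ennreal (exp (- e)) \<partial>exp_distr mu)
    = (\<integral>\<^sup>+e. ennreal (exponential_density mu e) * ennreal (exp (- e)) \<partial>lborel)"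
    by (subst nn_integral_density) auto
  also have "\<dots> = (\<integral>\<^sup>+e. ennreal (mu / (mu + 1)) * ennreal (exponential_density (mu + 1) e) \<partial>lborel)"
  proof (intro nn_integral_cong)
    fix e :: real
    have "exponential_density mu e * exp (- e) = mu / (mu + 1) * exponential_density (mu + 1) e"
      using mu by (simp add: exponential_density_def mult_exp_exp algebra_simps add_divide_distrib[symmetric])
        (simp add: field_simps)
    then show "ennreal (exponential_density mu e) * ennreal (exp (- e))
        = ennreal (mu / (mu + 1)) * ennreal (exponential_density (mu + 1) e)"
      using mu by (simp add: ennreal_mult'[symmetric] ennreal_mult''[symmetric])
  qed
  also have "\<dots> = ennreal (mu / (mu + 1)) * (\<integral>\<^sup>+e. ennreal (exponential_density (mu + 1) e) \<partial>lborel)"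
    by (rule nn_integral_cmult) simp
  also have "(\<integral>\<^sup>+e. ennreal (exponential_density (mu + 1) e) \<partial>lborel) = 1"
    using P.emeasure_space_1 by (simp add: emeasure_density)
  finally show ?thesis by simp
qed

lemma measurable_component_exp_distr:
  "(\<lambda>E. E m) \<in> borel_measurable (PiM (UNIV :: nat set) (\<lambda>_. exp_distr mu))"
  by (rule measurable_compose[OF measurable_component_singleton]) auto

lemma nn_integral_exp_neg_event_time:
  assumes mu: "0 < mu"
  shows "(\<integral>\<^sup>+E. ennreal (exp (- (\<Sum>l<m. E l))) \<partial>PiM UNIV (\<lambda>_. exp_distr mu)) = ennreal ((mu / (mu + 1)) ^ m)"
proof (induction m)
  case 0
  interpret prob_space "PiM (UNIV :: nat set) (\<lambda>_. exp_distr mu)"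
    by (rule prob_space_PiM) (rule prob_space_exponential_density[OF mu])
  show ?case by (simp add: emeasure_space_1)
next
  case (Suc m)
  note [measurable] = measurable_component_exp_distr
  have sum: "(\<Sum>l<Suc m. case_nat e E l) = e + (\<Sum>l<m. E l)" for e and E :: "nat \<Rightarrow> real"
    by (subst sum.lessThan_Suc_shift) simp
  have meas: "(\<lambda>E. ennreal (exp (- (\<Sum>l<k. E l)))) \<in> borel_measurable (PiM (UNIV :: nat set) (\<lambda>_. exp_distr mu))" for k
    by measurable
  have "(\<integral>\<^sup>+E. ennreal (exp (- (\<Sum>l<Suc m. E l))) \<partial>PiM UNIV (\<lambda>_. exp_distr mu))
    = (\<integral>\<^sup>+e. \<integral>\<^sup>+E. ennreal (exp (- (e + (\<Sum>l<m. E l)))) \<partial>PiM UNIV (\<lambda>_. exp_distr mu) \<partial>exp_distr mu)"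
    unfolding sum[symmetric]
    by (rule nn_integral_PiM_nat_split[OF prob_space_exponential_density[OF mu] meas])
  also have "\<dots> = (\<integral>\<^sup>+e. \<integral>\<^sup>+E. ennreal (exp (- e)) * ennreal (exp (- (\<Sum>l<m. E l))) \<partial>PiM UNIV (\<lambda>_. exp_distr mu) \<partial>exp_distr mu)"
    by (intro nn_integral_cong) (simp add: ennreal_mult[symmetric] mult_exp_exp)
  also have "\<dots> = (\<integral>\<^sup>+e. ennreal (exp (- e)) * ennreal ((mu / (mu + 1)) ^ m) \<partial>exp_distr mu)"
    by (subst nn_integral_cmult[OF meas]) (simp add: Suc.IH)
  also have "\<dots> = ennreal (mu / (mu + 1)) * ennreal ((mu / (mu + 1)) ^ m)"
    by (subst nn_integral_multc) (auto simp: nn_integral_exp_neg_exp_distr[OF mu])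
  also have "\<dots> = ennreal ((mu / (mu + 1)) ^ Suc m)"
    using mu by (simp add: ennreal_mult[symmetric])
  finally show ?case .
qed

text \<open>Chernoff: each event time \<open>S <= s\<close> contributes 1, which is at most
  \<open>exp (s - S)\<close>. If infinitely many events occur, \<open>card\<close> is 0 and the
  bound is trivial.\<close>

lemma event_count_le_suminf:
  "ennreal (real (event_count E s)) \<le> (\<Sum>m. ennreal (exp (s - (\<Sum>l<Suc m. E l))))"
proof (cases "finite {m. 1 \<le> m \<and> (\<Sum>l<m. E l) \<le> s}")
  case False
  then show ?thesis by (simp add: event_count_def)
next
  case True
  define B where "B = {m. (\<Sum>l<Suc m. E l) \<le> s}"
  have eq: "{m. 1 \<le> m \<and> (\<Sum>l<m. E l) \<le> s} = Suc ` B"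
    by (auto simp: B_def image_iff) (metis Suc_le_D One_nat_def sum.lessThan_Suc)
  then have fin: "finite B" using True by (simp add: finite_image_iff)
  have "ennreal (real (event_count E s)) = (\<Sum>m\<in>B. 1)"
    unfolding event_count_def eq by (simp add: card_image ennreal_of_nat_eq_real_of_nat)
  also have "\<dots> \<le> (\<Sum>m\<in>B. ennreal (exp (s - (\<Sum>l<Suc m. E l))))"
    by (intro sum_mono) (auto simp: B_def simp del: sum.lessThan_Suc)
  also have "\<dots> \<le> (\<Sum>m. ennreal (exp (s - (\<Sum>l<Suc m. E l))))"
    using fin by (intro sum_le_suminf) auto
  finally show ?thesis .
qed

text \<open>The geometric series with ratio \<open>q = mu / (mu + 1)\<close>, started at
  \<open>q\<close>, sums to \<open>mu\<close>. The factor \<open>exp s\<close> is crude; what counts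
  is linearity in \<open>mu\<close>, which cancels the event rate dividing the drift.\<close>

lemma nn_integral_event_count_le:
  assumes mu: "0 < mu"
  shows "(\<integral>\<^sup>+E. ennreal (real (event_count E s)) \<partial>PiM UNIV (\<lambda>_. exp_distr mu)) \<le> ennreal (exp s * mu)"
proof -
  note [measurable] = measurable_component_exp_distr
  let ?q = "mu / (mu + 1)"
  have q: "0 \<le> ?q" "?q < 1" using mu by auto
  have "(\<integral>\<^sup>+E. ennreal (real (event_count E s)) \<partial>PiM UNIV (\<lambda>_. exp_distr mu))
    \<le> (\<integral>\<^sup>+E. (\<Sum>m. ennreal (exp (s - (\<Sum>l<Suc m. E l)))) \<partial>PiM UNIV (\<lambda>_. exp_distr mu))"
    by (intro nn_integral_mono event_count_le_suminf)
  also have "\<dots> = (\<Sum>m. \<integral>\<^sup>+E. ennreal (exp (s - (\<Sum>l<Suc m. E l))) \<partial>PiM UNIV (\<lambda>_. exp_distr mu))"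
    by (rule nn_integral_suminf) measurable
  also have "\<dots> = (\<Sum>m. ennreal (exp s * ?q ^ Suc m))"
  proof (intro suminf_cong)
    fix m
    have "(\<integral>\<^sup>+E. ennreal (exp (s - (\<Sum>l<Suc m. E l))) \<partial>PiM UNIV (\<lambda>_. exp_distr mu))
      = (\<integral>\<^sup>+E. ennreal (exp s) * ennreal (exp (- (\<Sum>l<Suc m. E l))) \<partial>PiM UNIV (\<lambda>_. exp_distr mu))"
      by (intro nn_integral_cong) (simp add: ennreal_mult[symmetric] mult_exp_exp del: sum.lessThan_Suc)
    also have "\<dots> = ennreal (exp s) * ennreal (?q ^ Suc m)"
      by (subst nn_integral_cmult) (measurable, simp only: nn_integral_exp_neg_event_time[OF mu])
    also have "\<dots> = ennreal (exp s * ?q ^ Suc m)"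
      using q by (intro ennreal_mult[symmetric] zero_le_power) auto
    finally show "(\<integral>\<^sup>+E. ennreal (exp (s - (\<Sum>l<Suc m. E l))) \<partial>PiM UNIV (\<lambda>_. exp_distr mu)) = ennreal (exp s * ?q ^ Suc m)" .
  qed
  also have "\<dots> = ennreal (exp s * mu)"
  proof (rule suminf_ennreal_eq)
    have "(\<lambda>m. exp s * ?q * ?q ^ m) sums (exp s * ?q * (1 / (1 - ?q)))"
      using q by (intro sums_mult geometric_sums) (auto simp only: real_norm_def abs_of_nonneg)
    also have "exp s * ?q * (1 / (1 - ?q)) = exp s * mu"
      using mu by (simp add: field_simps)
    finally show "(\<lambda>m. exp s * ?q ^ Suc m) sums (exp s * mu)" by (simp add: mult.assoc)
  qed (use q in \<open>intro mult_nonneg_nonneg zero_le_power; simp\<close>)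
  finally show ?thesis .
qed

subsection \<open>Mean of the aggregate waiting time\<close>

lemma ennreal_enn2real_le: "ennreal (enn2real a) \<le> a"
  by (cases a) simp_all

lemma jsq_Z_eq_enn2real:
  "jsq_Z n lam w t = enn2real (\<integral>\<^sup>+s. ennreal (real (waiting (jsq_state n lam (fst w) (fst (snd w)) (snd (snd w)) s)))
      * indicator {0..t} s \<partial>lborel)"
  unfolding jsq_Z_def
  by (rule integral_eq_enn2real_nn_integral)
    (auto intro!: measurable_waiting measurable_jsq_state)

text \<open>Joint measurability in sample point and time, for any discrete \<open>M\<close>: it is
  applied to the initial law and to \<open>count_space UNIV\<close>, where the initial state is
  fixed.\<close>

lemma measurable_waiting_jsq_state:
  fixes M :: "(nat \<Rightarrow> nat) measure" and mu :: real
  assumes M: "sets M = UNIV"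
  shows "(\<lambda>p. real (waiting (jsq_state n lam (fst (fst p)) (fst (snd (fst p))) (snd (snd (fst p))) (snd p))))
    \<in> borel_measurable ((M \<Otimes>\<^sub>M (PiM (UNIV :: nat set) (\<lambda>_. exp_distr mu) \<Otimes>\<^sub>M PiM (UNIV :: nat set) (\<lambda>_. unif01))) \<Otimes>\<^sub>M lborel)"
proof (intro measurable_waiting measurable_jsq_state)
  let ?R = "(M \<Otimes>\<^sub>M (PiM (UNIV :: nat set) (\<lambda>_. exp_distr mu) \<Otimes>\<^sub>M PiM (UNIV :: nat set) (\<lambda>_. unif01))) \<Otimes>\<^sub>M lborel"
  have fst: "(\<lambda>p. fst (fst p)) \<in> ?R \<rightarrow>\<^sub>M M" by measurable
  have space: "space M = UNIV" using M sets.top[of M] by (metis UNIV_I sets.sets_into_space top.extremum_uniqueI)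
  have M_all: "(\<lambda>x. x i) \<in> M \<rightarrow>\<^sub>M count_space UNIV" for i
    unfolding measurable_def by (simp add: M space)
  show "(\<lambda>p. fst (fst p) i) \<in> ?R \<rightarrow>\<^sub>M count_space UNIV" for i
    by (rule measurable_compose[OF fst M_all])
  show "(\<lambda>p. fst (snd (fst p)) m) \<in> borel_measurable ?R" for m
    by (rule measurable_compose[OF _ measurable_component_exp_distr[of m mu]]) measurable
  show "(\<lambda>p. snd (snd (fst p)) m) \<in> borel_measurable ?R" for m
    by (rule measurable_compose[OF _ measurable_component_unif01[of m]]) measurable
  show "snd \<in> borel_measurable ?R"
    using measurable_snd[of "M \<Otimes>\<^sub>M (PiM UNIV (\<lambda>_. exp_distr mu) \<Otimes>\<^sub>M PiM (UNIV :: nat set) (\<lambda>_. unif01))" lborel]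
    by simp
qed

lemma measurable_jsq_Z:
  "(\<lambda>w. jsq_Z n lam w t) \<in> borel_measurable (jsq_space n lam init)"
  unfolding jsq_Z_eq_enn2real jsq_space_def
proof (intro borel_measurable_enn2real lborel.borel_measurable_nn_integral)
  let ?M = "measure_pmf init \<Otimes>\<^sub>M (PiM UNIV (\<lambda>_. exp_distr (lam * real n + real n)) \<Otimes>\<^sub>M PiM (UNIV :: nat set) (\<lambda>_. unif01))"
  note [measurable] = measurable_waiting_jsq_state[of "measure_pmf init" n lam "lam * real n + real n", simplified]
  show "(\<lambda>(w, s). ennreal (real (waiting (jsq_state n lam (fst w) (fst (snd w)) (snd (snd w)) s)))
      * indicator {0..t} s) \<in> borel_measurable (?M \<Otimes>\<^sub>M lborel)"
    unfolding split_beta' by measurable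
qed

text \<open>For a fixed initial state, Tonelli moves the expectation inside the time integral, and
  \<open>waiting <= sqrt n * potential\<close> brings in the chain estimate at each time.\<close>

lemma nn_integral_jsq_Z_le:
  assumes v: "valid_state n x" and n: "1 \<le> n" and lam: "0 < lam" "lam < 1" and t: "0 \<le> t"
  defines "mu \<equiv> lam * real n + real n"
  shows "(\<integral>\<^sup>+w. ennreal (jsq_Z n lam (x, w) t) \<partial>(PiM UNIV (\<lambda>_. exp_distr mu) \<Otimes>\<^sub>M PiM (UNIV :: nat set) (\<lambda>_. unif01)))
    \<le> ennreal (t * (sqrt (real n) * (potential n x + drift_bound n lam * exp t)))"
proof -
  have mu: "0 < mu" using n lam by (simp add: mu_def add_pos_pos)
  let ?E = "PiM (UNIV :: nat set) (\<lambda>_. exp_distr mu)" and ?U = "PiM (UNIV :: nat set) (\<lambda>_. unif01)"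
  interpret E: prob_space ?E
    by (rule prob_space_PiM) (rule prob_space_exponential_density[OF mu])
  interpret U: prob_space ?U
    by (rule prob_space_PiM) (rule prob_space_unif01)
  interpret EU: pair_prob_space ?E ?U ..
  interpret F: pair_sigma_finite "?E \<Otimes>\<^sub>M ?U" lborel ..
  define W where "W E U s = ennreal (real (waiting (jsq_state n lam x E U s)))" for E U s
  define d where "d = drift_bound n lam / mu"
  have d: "0 \<le> d" using mu by (simp add: d_def drift_bound_nonneg)
  have "(\<lambda>p. ((x, fst p), snd p)) \<in> (?E \<Otimes>\<^sub>M ?U) \<Otimes>\<^sub>M lborel \<rightarrow>\<^sub>M (count_space UNIV \<Otimes>\<^sub>M (?E \<Otimes>\<^sub>M ?U)) \<Otimes>\<^sub>M lborel"
    by measurable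
  from measurable_compose[OF this measurable_waiting_jsq_state[of "count_space UNIV" n lam mu]]
  have W[measurable]: "(\<lambda>p. W (fst (fst p)) (snd (fst p)) (snd p)) \<in> borel_measurable ((?E \<Otimes>\<^sub>M ?U) \<Otimes>\<^sub>M lborel)"
    by (simp add: W_def)
  have W_s: "(\<lambda>w. W (fst w) (snd w) s) \<in> borel_measurable (?E \<Otimes>\<^sub>M ?U)" for s
    using measurable_compose[OF measurable_Pair2'[of s lborel "?E \<Otimes>\<^sub>M ?U"] W] by simp
  have at_time: "(\<integral>\<^sup>+w. W (fst w) (snd w) s \<partial>(?E \<Otimes>\<^sub>M ?U))
      \<le> ennreal (sqrt (real n) * (potential n x + drift_bound n lam * exp s))" for s
  proof -
    have "(\<integral>\<^sup>+w. W (fst w) (snd w) s \<partial>(?E \<Otimes>\<^sub>M ?U)) = (\<integral>\<^sup>+E. \<integral>\<^sup>+U. W E U s \<partial>?U \<partial>?E)"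
      using U.nn_integral_fst[OF W_s, of s] by simp
    \<comment> \<open>Event times and marks are independent. For fixed \<open>E\<close> the number
      of events is a constant, so the bound for a deterministic number of steps applies to the inner
      integral over \<open>U\<close>.\<close>
    also have "\<dots> \<le> (\<integral>\<^sup>+E. ennreal (sqrt (real n)) * (ennreal (potential n x) + ennreal (real (event_count E s)) * ennreal d) \<partial>?E)"
    proof (intro nn_integral_mono)
      fix E
      have "(\<integral>\<^sup>+U. W E U s \<partial>?U)
        \<le> (\<integral>\<^sup>+U. ennreal (sqrt (real n)) * ennreal (potential n (jsq_chain n lam x U (event_count E s))) \<partial>?U)"
      proof (intro nn_integral_mono)
        fix U
        have "real (waiting (jsq_state n lam x E U s)) \<le> sqrt (real n) * potential n (jsq_chain n lam x U (event_count E s))"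
          using potential_ge_waiting[of "jsq_state n lam x E U s" n] n
          by (simp add: jsq_state_def field_simps)
        then show "W E U s \<le> ennreal (sqrt (real n)) * ennreal (potential n (jsq_chain n lam x U (event_count E s)))"
          by (simp add: W_def ennreal_mult'[symmetric] ennreal_leI)
      qed
      also have "\<dots> = ennreal (sqrt (real n)) * (\<integral>\<^sup>+U. ennreal (potential n (jsq_chain n lam x U (event_count E s))) \<partial>?U)"
        by (intro nn_integral_cmult measurable_compose[OF _ measurable_ennreal] measurable_potential measurable_jsq_chain measurable_component_unif01) simp
      also have "\<dots> \<le> ennreal (sqrt (real n)) * ennreal (potential n x + real (event_count E s) * d)"
        unfolding d_def mu_def by (intro mult_left_mono nn_integral_potential_chain v n lam) simp
      also have "ennreal (potential n x + real (event_count E s) * d) = ennreal (potential n x) + ennreal (real (event_count E s)) * ennreal d"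
        using d by (simp add: ennreal_plus potential_nonneg ennreal_mult)
      finally show "(\<integral>\<^sup>+U. W E U s \<partial>?U) \<le> ennreal (sqrt (real n)) * (ennreal (potential n x) + ennreal (real (event_count E s)) * ennreal d)" .
    qed
    also have "\<dots> = ennreal (sqrt (real n)) * (ennreal (potential n x) + (\<integral>\<^sup>+E. ennreal (real (event_count E s)) \<partial>?E) * ennreal d)"
    proof -
      have [measurable]: "(\<lambda>E. event_count E s) \<in> ?E \<rightarrow>\<^sub>M count_space UNIV"
        by (intro measurable_event_count measurable_component_exp_distr) simp
      show ?thesis
        by (simp add: nn_integral_cmult nn_integral_add nn_integral_multc E.emeasure_space_1)
    qed
    also have "\<dots> \<le> ennreal (sqrt (real n)) * (ennreal (potential n x) + ennreal (exp s * mu) * ennreal d)"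
      by (intro mult_left_mono add_left_mono mult_right_mono nn_integral_event_count_le mu) auto
    also have "\<dots> = ennreal (sqrt (real n) * (potential n x + exp s * mu * d))"
      using d mu by (simp add: ennreal_mult[symmetric] ennreal_plus[symmetric] potential_nonneg del: ennreal_plus)
    also have "exp s * mu * d = drift_bound n lam * exp s" using mu by (simp add: d_def)
    finally show ?thesis .
  qed
  have "(\<integral>\<^sup>+w. ennreal (jsq_Z n lam (x, w) t) \<partial>(?E \<Otimes>\<^sub>M ?U))
    \<le> (\<integral>\<^sup>+w. (\<integral>\<^sup>+s. W (fst w) (snd w) s * indicator {0..t} s \<partial>lborel) \<partial>(?E \<Otimes>\<^sub>M ?U))"
    unfolding jsq_Z_eq_enn2real W_def fst_conv snd_conv
    \<comment> \<open>Only an inequality, since \<open>enn2real\<close> loses an infinite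
      value.\<close>
    by (intro nn_integral_mono) (rule ennreal_enn2real_le)
  also have "\<dots> = (\<integral>\<^sup>+s. (\<integral>\<^sup>+w. W (fst w) (snd w) s * indicator {0..t} s \<partial>(?E \<Otimes>\<^sub>M ?U)) \<partial>lborel)"
    using F.Fubini[of "\<lambda>p. W (fst (fst p)) (snd (fst p)) (snd p) * indicator {0..t} (snd p)"] by simp
  also have "\<dots> = (\<integral>\<^sup>+s. (\<integral>\<^sup>+w. W (fst w) (snd w) s \<partial>(?E \<Otimes>\<^sub>M ?U)) * indicator {0..t} s \<partial>lborel)"
    by (simp add: nn_integral_multc[OF W_s])
  also have "\<dots> \<le> (\<integral>\<^sup>+s. ennreal (sqrt (real n) * (potential n x + drift_bound n lam * exp t)) * indicator {0..t} s \<partial>lborel)"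
  proof (intro nn_integral_mono)
    fix s :: real
    have "ennreal (sqrt (real n) * (potential n x + drift_bound n lam * exp s))
      \<le> ennreal (sqrt (real n) * (potential n x + drift_bound n lam * exp t))" if "s \<le> t"
      using that by (intro ennreal_leI mult_left_mono add_left_mono drift_bound_nonneg) auto
    then show "(\<integral>\<^sup>+w. W (fst w) (snd w) s \<partial>(?E \<Otimes>\<^sub>M ?U)) * indicator {0..t} s
      \<le> ennreal (sqrt (real n) * (potential n x + drift_bound n lam * exp t)) * indicator {0..t} s"
      using at_time[of s] by (auto simp: indicator_def intro: order_trans)
  qed
  also have "\<dots> = ennreal (sqrt (real n) * (potential n x + drift_bound n lam * exp t)) * ennreal t"
    using t by (simp add: nn_integral_cmult_indicator)
  also have "\<dots> = ennreal (t * (sqrt (real n) * (potential n x + drift_bound n lam * exp t)))"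
    using t by (subst ennreal_mult''[symmetric]) (auto simp: mult.commute)
  finally show ?thesis .
qed

text \<open>Union bound: either the initial potential exceeds \<open>K\<close>, or Markov's
  inequality applies. The cutoff \<open>K\<close> is there because the initial potential is
  controlled in probability, not in mean.\<close>

lemma measure_jsq_Z_le:
  assumes v: "\<And>x. x \<in> set_pmf init \<Longrightarrow> valid_state n x" and n: "1 \<le> n"
    and lam: "0 < lam" "lam < 1" and t: "0 \<le> t" and C: "0 < C" and K: "0 \<le> K"
  shows "measure (jsq_space n lam init) {w \<in> space (jsq_space n lam init). C * sqrt (real n) \<le> jsq_Z n lam w t}
    \<le> measure (measure_pmf init) {x. K < potential n x} + t * (K + drift_bound n lam * exp t) / C"
proof -
  define mu where "mu = lam * real n + real n"
  have mu: "0 < mu" using n lam by (simp add: mu_def add_pos_pos)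
  let ?E = "PiM (UNIV :: nat set) (\<lambda>_. exp_distr mu)" and ?U = "PiM (UNIV :: nat set) (\<lambda>_. unif01)"
  let ?J = "jsq_space n lam init"
  interpret E: prob_space ?E
    by (rule prob_space_PiM) (rule prob_space_exponential_density[OF mu])
  interpret U: prob_space ?U
    by (rule prob_space_PiM) (rule prob_space_unif01)
  interpret EU: pair_prob_space ?E ?U ..
  interpret J: pair_prob_space "measure_pmf init" "?E \<Otimes>\<^sub>M ?U" ..
  have J: "?J = measure_pmf init \<Otimes>\<^sub>M (?E \<Otimes>\<^sub>M ?U)" by (simp add: jsq_space_def mu_def)
  define B where "B = t * (K + drift_bound n lam * exp t)"
  have B: "0 \<le> B" using t K by (simp add: B_def drift_bound_nonneg)
  have r: "0 < sqrt (real n)" using n by simp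
  note [measurable] = measurable_jsq_Z[of n lam t init, unfolded J]
  define bad where "bad = {x. K < potential n x}"
  \<comment> \<open>Cutting off by the initial state alone leaves the estimate for each fixed good
    \<open>x\<close> intact.\<close>
  define Z where "Z w = ennreal (jsq_Z n lam w t) * indicator (- bad) (fst w)" for w
  have [measurable]: "Z \<in> borel_measurable (measure_pmf init \<Otimes>\<^sub>M (?E \<Otimes>\<^sub>M ?U))"
    unfolding Z_def J[symmetric]
    by (intro borel_measurable_times_ennreal measurable_compose[OF measurable_jsq_Z measurable_ennreal]
        measurable_compose[OF measurable_fst[of "measure_pmf init" "?E \<Otimes>\<^sub>M ?U", folded J]]) simp
  have "emeasure ?J {w \<in> space ?J. C * sqrt (real n) \<le> jsq_Z n lam w t}
    \<le> emeasure ?J ((bad \<times> space (?E \<Otimes>\<^sub>M ?U)) \<union> {w \<in> space ?J. 1 \<le> ennreal (1 / (C * sqrt (real n))) * Z w})"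
  proof (rule emeasure_mono)
    show "{w \<in> space ?J. C * sqrt (real n) \<le> jsq_Z n lam w t}
      \<subseteq> (bad \<times> space (?E \<Otimes>\<^sub>M ?U)) \<union> {w \<in> space ?J. 1 \<le> ennreal (1 / (C * sqrt (real n))) * Z w}"
    proof
      fix w assume w: "w \<in> {w \<in> space ?J. C * sqrt (real n) \<le> jsq_Z n lam w t}"
      show "w \<in> (bad \<times> space (?E \<Otimes>\<^sub>M ?U)) \<union> {w \<in> space ?J. 1 \<le> ennreal (1 / (C * sqrt (real n))) * Z w}"
      proof (cases "fst w \<in> bad")
        case True
        then show ?thesis using w by (auto simp: J space_pair_measure)
      next
        case False
        have "1 \<le> 1 / (C * sqrt (real n)) * jsq_Z n lam w t"
          using w C r by (simp add: field_simps)
        then have "ennreal 1 \<le> ennreal (1 / (C * sqrt (real n)) * jsq_Z n lam w t)" by (rule ennreal_leI)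
        then have "1 \<le> ennreal (1 / (C * sqrt (real n))) * Z w"
          using C False by (subst (asm) ennreal_mult') (auto simp: Z_def)
        then show ?thesis using w by simp
      qed
    qed
  qed (auto simp: J)
  also have "\<dots> \<le> emeasure ?J (bad \<times> space (?E \<Otimes>\<^sub>M ?U)) + emeasure ?J {w \<in> space ?J. 1 \<le> ennreal (1 / (C * sqrt (real n))) * Z w}"
    by (rule emeasure_subadditive) (auto simp: J)
  also have "emeasure ?J (bad \<times> space (?E \<Otimes>\<^sub>M ?U)) = emeasure (measure_pmf init) bad"
    unfolding J by (subst EU.emeasure_pair_measure_Times) (auto simp: EU.emeasure_space_1)
  also have "emeasure ?J {w \<in> space ?J. 1 \<le> ennreal (1 / (C * sqrt (real n))) * Z w} \<le> ennreal (B / C)"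
  proof -
    have "emeasure ?J {w \<in> space ?J. 1 \<le> ennreal (1 / (C * sqrt (real n))) * Z w}
      \<le> ennreal (1 / (C * sqrt (real n))) * (\<integral>\<^sup>+w. Z w * indicator (space ?J) w \<partial>?J)"
      by (rule nn_integral_Markov_inequality) (auto simp: J)
    also have "(\<integral>\<^sup>+w. Z w * indicator (space ?J) w \<partial>?J) = (\<integral>\<^sup>+w. Z w \<partial>?J)"
      by (intro nn_integral_cong) simp
    also have "\<dots> = (\<integral>\<^sup>+x. \<integral>\<^sup>+w. Z (x, w) \<partial>(?E \<Otimes>\<^sub>M ?U) \<partial>measure_pmf init)"
      unfolding J by (rule EU.nn_integral_fst[symmetric]) measurable
    also have "\<dots> \<le> (\<integral>\<^sup>+x. ennreal (sqrt (real n) * B) \<partial>measure_pmf init)"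
    proof (rule nn_integral_mono_AE, rule AE_pmfI)
      fix x assume x: "x \<in> set_pmf init"
      show "(\<integral>\<^sup>+w. Z (x, w) \<partial>(?E \<Otimes>\<^sub>M ?U)) \<le> ennreal (sqrt (real n) * B)"
      proof (cases "x \<in> bad")
        case True
        then show ?thesis by (simp add: Z_def)
      next
        case False
        have "(\<integral>\<^sup>+w. Z (x, w) \<partial>(?E \<Otimes>\<^sub>M ?U)) = (\<integral>\<^sup>+w. ennreal (jsq_Z n lam (x, w) t) \<partial>(?E \<Otimes>\<^sub>M ?U))"
          using False by (simp add: Z_def)
        also have "\<dots> \<le> ennreal (t * (sqrt (real n) * (potential n x + drift_bound n lam * exp t)))"
          unfolding mu_def by (rule nn_integral_jsq_Z_le[OF v[OF x] n lam t])
        also have "\<dots> \<le> ennreal (t * (sqrt (real n) * (K + drift_bound n lam * exp t)))"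
          using False t by (auto simp: bad_def intro!: ennreal_leI mult_left_mono add_right_mono)
        finally show ?thesis by (simp add: B_def mult_ac)
      qed
    qed
    also have "\<dots> = ennreal (sqrt (real n) * B)"
      by simp
    finally have "emeasure ?J {w \<in> space ?J. 1 \<le> ennreal (1 / (C * sqrt (real n))) * Z w}
      \<le> ennreal (1 / (C * sqrt (real n))) * ennreal (sqrt (real n) * B)"
      by (simp add: mult_left_mono)
    also have "\<dots> = ennreal (B / C)"
      using C r B by (subst ennreal_mult[symmetric]) (auto simp: field_simps)
    finally show ?thesis .
  qed
  finally have "emeasure ?J {w \<in> space ?J. C * sqrt (real n) \<le> jsq_Z n lam w t}
    \<le> ennreal (measure (measure_pmf init) bad + B / C)"
    using B C by (simp add: measure_pmf.emeasure_eq_measure ennreal_plus add_left_mono)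
  then show ?thesis
    using B C unfolding J J.P.emeasure_eq_measure bad_def[symmetric]
    by (subst (asm) ennreal_le_iff) (auto simp: B_def[symmetric])
qed

subsection \<open>Tightness of the initial condition and conclusion\<close>

text \<open>Coordinate 0 is \<open>- I / sqrt n\<close> and the others add up to
  \<open>W / sqrt n\<close>, because no level above \<open>k\<close> is occupied. The potential is
  thus a continuous function of the scaled vector.\<close>

lemma potential_eq_init_scaled:
  assumes "1 \<le> k" "\<And>i. k < i \<Longrightarrow> x i = 0"
  shows "potential n x = (\<Sum>j<k. init_scaled n k x j) + 2 * (init_scaled n k x 0)\<^sup>2 + 1"
proof -
  have "waiting x = (\<Sum>i\<in>{2..<Suc k}. x i)"
    by (rule waiting_eq_sum) (use assms in auto)
  also have "\<dots> = (\<Sum>j\<in>{1..<k}. x (Suc j))"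
    using sum.shift_bounds_Suc_ivl[of x 1 k] by (simp add: numeral_2_eq_2)
  finally have "real (waiting x) / sqrt (real n) = (\<Sum>j\<in>{1..<k}. init_scaled n k x j)"
    by (simp add: init_scaled_def sum_divide_distrib)
  moreover have "(\<Sum>j<k. init_scaled n k x j) = init_scaled n k x 0 + (\<Sum>j\<in>{1..<k}. init_scaled n k x j)"
    using assms(1) by (simp add: lessThan_atLeast0 sum.atLeast_Suc_lessThan)
  ultimately show ?thesis
    by (simp add: potential_def init_scaled_def diff_divide_distrib power2_commute power_divide)
qed

text \<open>One tail estimate from the portmanteau circle. Under the limit law the mean of the ramp
  at height \<open>m\<close> tends to 0 by dominated convergence; a suitable \<open>m\<close> is
  fixed and the estimate is transferred by weak convergence.\<close>

lemma weak_convergence_tight: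
  fixes X :: "nat \<Rightarrow> 'a \<Rightarrow> 'b :: topological_space" and h :: "'b \<Rightarrow> real" and p :: "nat \<Rightarrow> 'a pmf"
  assumes mu: "prob_space mu" "sets mu = sets borel"
    and h: "continuous_on UNIV h"
    and weak: "\<And>f :: 'b \<Rightarrow> real. continuous_on UNIV f \<Longrightarrow> bounded (range f) \<Longrightarrow>
      (\<lambda>n. measure_pmf.expectation (p n) (\<lambda>x. f (X n x))) \<longlonglongrightarrow> integral\<^sup>L mu f"
    and e: "0 < e"
  shows "\<exists>K\<ge>0. eventually (\<lambda>n. measure (measure_pmf (p n)) {x. K < h (X n x)} < e) sequentially"
proof -
  interpret prob_space mu by fact
  \<comment> \<open>Continuous ramps dominating the indicators of \<open>h > m + 1\<close>.\<close>
  define f where "f m y = min 1 (max 0 (h y - real m))" for m :: nat and y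
  have cont: "continuous_on UNIV (f m)" for m
    unfolding f_def by (intro continuous_intros h)
  have bnd: "0 \<le> f m y" "f m y \<le> 1" for m y by (auto simp: f_def)
  have meas: "f m \<in> borel_measurable mu" for m
    using borel_measurable_continuous_onI[OF cont[of m]] mu(2) by (simp add: measurable_def sets_eq_imp_space_eq[OF mu(2)])
  have "(\<lambda>m. integral\<^sup>L mu (f m)) \<longlonglongrightarrow> integral\<^sup>L mu (\<lambda>_. 0)"
  proof (rule integral_dominated_convergence[where w = "\<lambda>_. 1"])
    show "AE y in mu. (\<lambda>m. f m y) \<longlonglongrightarrow> 0"
    proof (rule AE_I2)
      fix y
      obtain m0 :: nat where "h y \<le> real m0" using real_arch_simple by blast
      then have "eventually (\<lambda>m. f m y = 0) sequentially"
        by (intro eventually_sequentiallyI[of m0]) (auto simp: f_def)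
      then show "(\<lambda>m. f m y) \<longlonglongrightarrow> 0" by (rule tendsto_eventually)
    qed
  qed (use meas bnd in auto)
  then have "eventually (\<lambda>m. integral\<^sup>L mu (f m) < e) sequentially"
    using e by (intro order_tendstoD(2)) simp_all
  then obtain m where m: "integral\<^sup>L mu (f m) < e"
    by (auto simp: eventually_sequentially)
  have "bounded (range (f m))"
    using bnd by (intro boundedI[where B = 1]) (auto simp: abs_le_iff intro: order_trans[of _ 0])
  from order_tendstoD(2)[OF weak[OF cont this] m]
  have "eventually (\<lambda>n. measure (measure_pmf (p n)) {x. real m + 1 < h (X n x)} < e) sequentially"
  proof eventually_elim
    case (elim n)
    have "measure (measure_pmf (p n)) {x. real m + 1 < h (X n x)}
      = measure_pmf.expectation (p n) (indicator {x. real m + 1 < h (X n x)})"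
      by simp
    also have "\<dots> \<le> measure_pmf.expectation (p n) (\<lambda>x. f m (X n x))"
      using bnd by (intro integral_mono measure_pmf.integrable_const_bound[where B = 1])
        (auto simp: indicator_def f_def)
    finally show ?case using elim by simp
  qed
  then show ?thesis by (intro exI[of _ "real m + 1"]) simp
qed

text \<open>The first conjunct certifies that the event is measurable, so its \<open>measure\<close>
  is a genuine probability and not the default 0.\<close>

theorem mainTheorem11:
  fixes lam :: "nat \<Rightarrow> real" and beta :: real and k :: nat
    and init :: "nat \<Rightarrow> (nat \<Rightarrow> nat) pmf" and t :: real
  assumes lam_pos: "\<And>n. 0 < lam n" and lam_lt1: "\<And>n. lam n < 1"
    and heavy: "(\<lambda>n. sqrt (real n) * (1 - lam n)) \<longlonglongrightarrow> beta" and beta_pos: "0 < beta"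
    and k3: "3 \<le> k"
    and init_valid: "\<And>n x. x \<in> set_pmf (init n) \<Longrightarrow> valid_state n x"
    and init_k: "\<And>n x i. x \<in> set_pmf (init n) \<Longrightarrow> k < i \<Longrightarrow> x i = 0"
    and init_weak: "\<exists>\<mu>. prob_space \<mu> \<and> sets \<mu> = sets (borel :: (nat \<Rightarrow> real) measure) \<and>
        (\<forall>f :: (nat \<Rightarrow> real) \<Rightarrow> real. continuous_on UNIV f \<and> bounded (range f) \<longrightarrow>
           (\<lambda>n. measure_pmf.expectation (init n) (\<lambda>x. f (init_scaled n k x)))
             \<longlonglongrightarrow> integral\<^sup>L \<mu> f)"
    and t_nonneg: "0 \<le> t"
  shows "(\<forall>n C. 1 \<le> n \<longrightarrow>
            {\<omega> \<in> space (jsq_space n (lam n) (init n)). C * sqrt (real n) \<le> jsq_Z n (lam n) \<omega> t}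
              \<in> sets (jsq_space n (lam n) (init n)))
         \<and> ((\<lambda>C. limsup (\<lambda>n. ereal (measure (jsq_space n (lam n) (init n))
               {\<omega> \<in> space (jsq_space n (lam n) (init n)). C * sqrt (real n) \<le> jsq_Z n (lam n) \<omega> t})))
             \<longlongrightarrow> 0) at_top"
proof (intro conjI allI impI)
  fix n and C :: real
  note [measurable] = measurable_jsq_Z[of n "lam n" t "init n"]
  show "{\<omega> \<in> space (jsq_space n (lam n) (init n)). C * sqrt (real n) \<le> jsq_Z n (lam n) \<omega> t}
              \<in> sets (jsq_space n (lam n) (init n))"
    by measurable
next
  define P where "P n C = measure (jsq_space n (lam n) (init n))
     {\<omega> \<in> space (jsq_space n (lam n) (init n)). C * sqrt (real n) \<le> jsq_Z n (lam n) \<omega> t}" for n C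
  define h where "h y = (\<Sum>j<k. y j) + 2 * (y 0)\<^sup>2 + 1" for y :: "nat \<Rightarrow> real"
  have h: "continuous_on UNIV h"
    unfolding h_def by (intro continuous_intros) auto
  \<comment> \<open>A convergent sequence is bounded, which makes the drift bound uniform in
    \<open>n\<close>.\<close>
  from convergent_imp_Bseq[OF convergentI[OF heavy]]
  obtain b where b: "\<And>n. \<bar>sqrt (real n) * (1 - lam n)\<bar> \<le> b" by (auto simp: Bseq_def)
  have drift: "drift_bound n (lam n) \<le> 4 + (1 + 4 * b)\<^sup>2" for n
  proof -
    have "0 \<le> sqrt (real n) * (1 - lam n)" using lam_lt1[of n] by simp
    then show ?thesis using b[of n] by (auto simp: drift_bound_def intro!: power_mono)
  qed
  have small: "eventually (\<lambda>C. limsup (\<lambda>n. ereal (P n C)) \<le> ereal (2 * e)) at_top" if e: "0 < e" for e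
  proof -
    obtain \<mu> where \<mu>: "prob_space \<mu>" "sets \<mu> = sets (borel :: (nat \<Rightarrow> real) measure)"
      "\<And>f :: (nat \<Rightarrow> real) \<Rightarrow> real. continuous_on UNIV f \<Longrightarrow> bounded (range f) \<Longrightarrow>
           (\<lambda>n. measure_pmf.expectation (init n) (\<lambda>x. f (init_scaled n k x)))
             \<longlonglongrightarrow> integral\<^sup>L \<mu> f"
      using init_weak by blast
    from weak_convergence_tight[where X = "\<lambda>n. init_scaled n k" and p = init, OF \<mu>(1,2) h \<mu>(3) e]
    obtain K where K: "0 \<le> K"
      "eventually (\<lambda>n. measure (measure_pmf (init n)) {x. K < h (init_scaled n k x)} < e) sequentially"
      by auto
    \<comment> \<open>Numerator of the Markov term with the uniform drift bound. \<open>K\<close>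
      depends on \<open>e\<close> only, so \<open>C\<close> can be chosen after it with
      \<open>B / C <= e\<close>.\<close>
    define B where "B = t * (K + (4 + (1 + 4 * b)\<^sup>2) * exp t)"
    have "eventually (\<lambda>C. max 1 (B / e) \<le> C) at_top" by (rule eventually_ge_at_top)
    then show ?thesis
    proof eventually_elim
      case (elim C)
      then have C: "0 < C" "B / C \<le> e" using e by (auto simp: field_simps)
      have "eventually (\<lambda>n. ereal (P n C) \<le> ereal (2 * e)) sequentially"
        using K(2) eventually_ge_at_top[of 1]
      proof eventually_elim
        case (elim n)
        \<comment> \<open>The identity holds only on the support of \<open>init n\<close>, so the
          two probabilities are compared almost everywhere.\<close>
        have "K < potential n x \<longleftrightarrow> K < h (init_scaled n k x)" if "x \<in> set_pmf (init n)" for x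
          using k3 potential_eq_init_scaled[of k x n] init_k[OF that] by (simp add: h_def)
        then have "measure (measure_pmf (init n)) {x. K < potential n x}
          = measure (measure_pmf (init n)) {x. K < h (init_scaled n k x)}"
          by (intro measure_pmf.finite_measure_eq_AE AE_pmfI) auto
        moreover have "P n C \<le> measure (measure_pmf (init n)) {x. K < potential n x} + t * (K + drift_bound n (lam n) * exp t) / C"
          unfolding P_def using elim C(1) K(1)
          by (intro measure_jsq_Z_le init_valid lam_pos lam_lt1 t_nonneg) auto
        moreover have "t * (K + drift_bound n (lam n) * exp t) / C \<le> B / C"
          unfolding B_def using C(1) t_nonneg drift[of n]
          by (intro divide_right_mono mult_left_mono add_left_mono mult_right_mono) auto
        ultimately show ?case using elim C(2) by simp
      qed
      then show ?case by (rule Limsup_bounded)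
    qed
  qed
  have nonneg: "0 \<le> limsup (\<lambda>n. ereal (P n C))" for C
    by (rule le_Limsup) (auto simp: P_def)
  have "((\<lambda>C. limsup (\<lambda>n. ereal (P n C))) \<longlongrightarrow> 0) at_top"
  proof (rule order_tendstoI)
    fix a :: ereal assume "a < 0"
    then show "eventually (\<lambda>C. a < limsup (\<lambda>n. ereal (P n C))) at_top"
      using nonneg by (intro always_eventually allI) (rule less_le_trans)
  next
    fix a :: ereal assume "0 < a"
    then obtain e where e: "0 < ereal e" "ereal e < a" by (rule ereal_dense2[THEN exE]) auto
    then have "eventually (\<lambda>C. limsup (\<lambda>n. ereal (P n C)) \<le> ereal (2 * (e / 2))) at_top"
      by (intro small) simp
    then show "eventually (\<lambda>C. limsup (\<lambda>n. ereal (P n C)) < a) at_top"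
      using e by (auto elim!: eventually_mono intro: le_less_trans)
  qed
  then show "((\<lambda>C. limsup (\<lambda>n. ereal (measure (jsq_space n (lam n) (init n))
               {\<omega> \<in> space (jsq_space n (lam n) (init n)). C * sqrt (real n) \<le> jsq_Z n (lam n) \<omega> t})))
             \<longlongrightarrow> 0) at_top"
    unfolding P_def .
qed

end
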